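(* Let $\alpha$ be a closed, regular, smooth plane curve of length $l$, parametrized by arc length $s\in\mathbb{S}^1=\mathbb{R}/l\mathbb{Z}$, with curvature $k(s)>0$ for all $s$, and let $\beta(s)=\alpha(s)+\frac{1}{k(s)}n(s)$ be its evolute. Let $p$ be a point in the plane that is not on $\alpha$ or $\beta$, and let $n_p$ be the number of normal segments to $\alpha$ through $p$. Then $$w^\beta_p=r^\alpha-n_p.$$
   Context: The unit tangent is $t=\dot\alpha$ and $n$ is the unit normal such that $(t,n)$ is right-handed; the curvature $k$ is defined by $\dot t=k n$ (equivalently $\dot n=-kt$). The curve may have self-intersections. The normal segment to $\alpha$ at $\alpha(s)$ is the set of points $\alpha(s)+\rho\,n(s)$ with $-\infty<\rho<1/k(s)$; thus $n_p$ is the number of parameters $s\in\mathbb{S}^1$ for which there is $\rho<1/k(s)$ with $\alpha(s)+\rho\,n(s)=p$. The rotation index $r^\alpha$ is the degree of the map $\dot\alpha/|\dot\alpha|:\mathbb{S}^1\to\mathbb{S}^1$. The winding index $w^\beta_p$ of the closed curve $\beta$ (parametrized by $s$) about $p$ is the degree of the map $(\beta-p)/|\beta-p|:\mathbb{S}^1\to\mathbb{S}^1$. *)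

theory Defs
  imports "HOL-Complex_Analysis.Complex_Analysis"
begin

text \<open>
  The Euclidean plane is the type \<^typ>\<open>complex\<close>. A map on the circle
  \<open>\<real>/l\<int>\<close> is a function on \<^typ>\<open>real\<close> that is periodic with period \<open>l\<close>
  (not necessarily the least one); \<open>{0..<l}\<close> represents each parameter
  exactly once.
\<close>

definition smooth_curve :: "(real \<Rightarrow> complex) \<Rightarrow> bool" where
  "smooth_curve \<gamma> \<longleftrightarrow>
     (\<forall>m s. ((\<lambda>f x. vector_derivative f (at x)) ^^ m) \<gamma> differentiable at s)"

definition closed_unit_speed_curve :: "real \<Rightarrow> (real \<Rightarrow> complex) \<Rightarrow> bool" where
  "closed_unit_speed_curve l \<alpha> \<longleftrightarrow>
     l > 0 \<and> smooth_curve \<alpha> \<and> (\<forall>s. \<alpha> (s + l) = \<alpha> s) \<and>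
     (\<forall>s. norm (vector_derivative \<alpha> (at s)) = 1)"

text \<open>
  The following notions are meant for unit-speed curves. Multiplication by
  \<open>\<i>\<close> is the counterclockwise rotation by a right angle.
\<close>

definition unit_tangent :: "(real \<Rightarrow> complex) \<Rightarrow> real \<Rightarrow> complex" where
  "unit_tangent \<alpha> s = vector_derivative \<alpha> (at s)"

definition unit_normal :: "(real \<Rightarrow> complex) \<Rightarrow> real \<Rightarrow> complex" where
  "unit_normal \<alpha> s = \<i> * unit_tangent \<alpha> s"

definition curvature :: "(real \<Rightarrow> complex) \<Rightarrow> real \<Rightarrow> real" where
  "curvature \<alpha> s =
     (THE \<kappa>. (unit_tangent \<alpha> has_vector_derivative \<kappa> *\<^sub>R unit_normal \<alpha> s) (at s))"

definition evolute :: "(real \<Rightarrow> complex) \<Rightarrow> real \<Rightarrow> complex" where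
  "evolute \<alpha> s = \<alpha> s + (1 / curvature \<alpha> s) *\<^sub>R unit_normal \<alpha> s"

definition normal_segment :: "(real \<Rightarrow> complex) \<Rightarrow> real \<Rightarrow> complex set" where
  "normal_segment \<alpha> s = {\<alpha> s + \<rho> *\<^sub>R unit_normal \<alpha> s |\<rho>. \<rho> < 1 / curvature \<alpha> s}"

text \<open>
  The degree of a continuous map from \<open>\<real>/l\<int>\<close> to the unit circle, obtained
  from a continuous lift \<open>\<theta>\<close> of its angle over one period. Lemma
  \<open>circle_degree_eqI\<close> shows that any lift determines the value, and
  \<open>circle_degree_eq_winding_number\<close> that it agrees with \<^const>\<open>winding_number\<close>.
\<close>

definition circle_degree :: "real \<Rightarrow> (real \<Rightarrow> complex) \<Rightarrow> int" where
  "circle_degree l f =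
     (THE d. \<exists>\<theta>. continuous_on {0..l} \<theta> \<and> (\<forall>s\<in>{0..l}. f s = cis (\<theta> s)) \<and>
                 \<theta> l - \<theta> 0 = 2 * pi * of_int d)"

definition rotation_index :: "real \<Rightarrow> (real \<Rightarrow> complex) \<Rightarrow> int" where
  "rotation_index l \<gamma> =
     circle_degree l (\<lambda>s. vector_derivative \<gamma> (at s) /\<^sub>R norm (vector_derivative \<gamma> (at s)))"

definition winding_index :: "real \<Rightarrow> (real \<Rightarrow> complex) \<Rightarrow> complex \<Rightarrow> int" where
  "winding_index l \<gamma> p = circle_degree l (\<lambda>s. (\<gamma> s - p) /\<^sub>R norm (\<gamma> s - p))"

lemma frenet_equation:
  assumes "closed_unit_speed_curve l \<alpha>"
  shows "(unit_tangent \<alpha> has_vector_derivative curvature \<alpha> s *\<^sub>R unit_normal \<alpha> s) (at s)"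
proof -
  let ?T = "unit_tangent \<alpha>"
  have T: "?T = (\<lambda>x. vector_derivative \<alpha> (at x))"
    by (simp add: unit_tangent_def fun_eq_iff)
  have "((\<lambda>f x. vector_derivative f (at x)) ^^ 1) \<alpha> differentiable at s"
    using assms unfolding closed_unit_speed_curve_def smooth_curve_def by blast
  then obtain D where D: "(?T has_vector_derivative D) (at s)"
    unfolding T by (auto simp: vector_derivative_works)
  have nrm: "norm (?T x) = 1" for x
    using assms by (simp add: T closed_unit_speed_curve_def)
  have "((\<lambda>x. ?T x \<bullet> ?T x) has_real_derivative (?T s \<bullet> D + D \<bullet> ?T s)) (at s)"
    using D unfolding has_vector_derivative_def has_field_derivative_def
    by (auto intro!: derivative_eq_intros simp: fun_eq_iff algebra_simps)
  moreover have "((\<lambda>x. ?T x \<bullet> ?T x) has_real_derivative 0) (at s)"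
    using nrm by (simp add: dot_square_norm)
  ultimately have "?T s \<bullet> D + D \<bullet> ?T s = 0"
    by (rule DERIV_unique)
  then have orth: "Re (?T s) * Re D + Im (?T s) * Im D = 0"
    by (simp add: inner_complex_def algebra_simps)
  have unit: "Re (?T s) * Re (?T s) + Im (?T s) * Im (?T s) = 1"
    using nrm[of s] by (simp add: cmod_def power2_eq_square)
  define \<kappa> where "\<kappa> = Re (?T s) * Im D - Im (?T s) * Re D"
  have "\<kappa> * Im (?T s) + Re D =
      Re (?T s) * (Re (?T s) * Re D + Im (?T s) * Im D)
      + (1 - (Re (?T s) * Re (?T s) + Im (?T s) * Im (?T s))) * Re D"
    by (simp add: \<kappa>_def algebra_simps)
  then have 1: "Re D = - \<kappa> * Im (?T s)"
    using orth unit by simp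
  have "Im D - \<kappa> * Re (?T s) =
      Im (?T s) * (Re (?T s) * Re D + Im (?T s) * Im D)
      + (1 - (Re (?T s) * Re (?T s) + Im (?T s) * Im (?T s))) * Im D"
    by (simp add: \<kappa>_def algebra_simps)
  then have 2: "Im D = \<kappa> * Re (?T s)"
    using orth unit by simp
  from 1 2 have "D = \<kappa> *\<^sub>R unit_normal \<alpha> s"
    by (simp add: complex_eq_iff unit_normal_def)
  then have ex: "(?T has_vector_derivative \<kappa> *\<^sub>R unit_normal \<alpha> s) (at s)"
    using D by simp
  moreover have "unit_normal \<alpha> s \<noteq> 0"
    using nrm[of s] by (auto simp: unit_normal_def)
  ultimately have "\<kappa>' = \<kappa>"
    if "(?T has_vector_derivative \<kappa>' *\<^sub>R unit_normal \<alpha> s) (at s)" for \<kappa>'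
    using vector_derivative_unique_at[OF that ex] by simp
  with ex show ?thesis
    unfolding curvature_def by (rule theI)
qed

lemma circle_degree_eqI:
  assumes "l > 0" "continuous_on {0..l} \<theta>" "\<And>s. s \<in> {0..l} \<Longrightarrow> f s = cis (\<theta> s)"
    and "\<theta> l - \<theta> 0 = 2 * pi * of_int d"
  shows "circle_degree l f = d"
  unfolding circle_degree_def
proof (rule the_equality)
  show "\<exists>\<theta>. continuous_on {0..l} \<theta> \<and> (\<forall>s\<in>{0..l}. f s = cis (\<theta> s)) \<and>
            \<theta> l - \<theta> 0 = 2 * pi * of_int d"
    using assms by blast
next
  fix e :: int
  assume "\<exists>\<theta>. continuous_on {0..l} \<theta> \<and> (\<forall>s\<in>{0..l}. f s = cis (\<theta> s)) \<and>
              \<theta> l - \<theta> 0 = 2 * pi * of_int e"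
  then obtain \<phi> where \<phi>: "continuous_on {0..l} \<phi>" "\<And>s. s \<in> {0..l} \<Longrightarrow> f s = cis (\<phi> s)"
      "\<phi> l - \<phi> 0 = 2 * pi * of_int e"
    by blast
  define g where "g s = (\<phi> s - \<theta> s) / (2 * pi)" for s
  have "g s \<in> \<int>" if "s \<in> {0..l}" for s
  proof -
    have "cis (\<phi> s - \<theta> s) = 1"
      using assms(3)[OF that] \<phi>(2)[OF that] by (simp add: cis_divide [symmetric])
    then have "cos (\<phi> s - \<theta> s) = 1"
      by (metis cis.sel(1) one_complex.sel(1))
    then obtain m :: int where "\<phi> s - \<theta> s = of_int m * 2 * pi"
      using cos_one_2pi_int by blast
    then show ?thesis
      by (simp add: g_def)
  qed
  moreover have "continuous_on {0..l} g"
    unfolding g_def by (intro continuous_intros \<phi> assms) auto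
  moreover have "1 \<le> norm (x - y)" if "x \<in> \<int>" "y \<in> \<int>" "x \<noteq> y" for x y :: real
    using that Ints_nonzero_abs_ge1[of "x - y"] by simp
  ultimately have "g constant_on {0..l}"
    by (intro continuous_discrete_range_constant) (auto intro!: exI[of _ 1])
  then have "g l = g 0"
    using \<open>l > 0\<close> by (auto simp: constant_on_def)
  then have "\<phi> l - \<phi> 0 = \<theta> l - \<theta> 0"
    by (simp add: g_def field_simps)
  then show "e = d"
    using \<phi>(3) assms(4) by simp
qed

lemma circle_degree_eq_winding_number:
  assumes "l > 0" "continuous_on {0..l} g" "g l = g 0" "p \<notin> g ` {0..l}"
  shows "of_int (circle_degree l (\<lambda>s. (g s - p) /\<^sub>R norm (g s - p))) =
         winding_number (\<lambda>t. g (l * t)) p"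
proof -
  let ?g = "\<lambda>t. g (l * t)"
  have "path ?g"
    unfolding path_def
    by (rule continuous_on_compose2[OF assms(2)])
       (use \<open>l > 0\<close> in \<open>auto intro!: continuous_intros simp: mult_left_le\<close>)
  moreover have "p \<notin> path_image ?g"
    using assms(1,4) by (auto simp: path_image_def mult_left_le)
  ultimately obtain q where q: "path q"
      "pathfinish q - pathstart q = 2 * of_real pi * \<i> * winding_number ?g p"
      "\<And>t. t \<in> {0..1} \<Longrightarrow> g (l * t) = p + exp (q t)"
    using winding_number_as_continuous_log by blast
  have "winding_number ?g p \<in> \<int>"
    using \<open>path ?g\<close> \<open>p \<notin> path_image ?g\<close> assms(3)
    by (intro integer_winding_number) (auto simp: pathfinish_def pathstart_def)
  then obtain d where d: "winding_number ?g p = of_int d"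
    by (rule Ints_cases)
  have "circle_degree l (\<lambda>s. (g s - p) /\<^sub>R norm (g s - p)) = d"
  proof (rule circle_degree_eqI[where \<theta> = "\<lambda>s. Im (q (s / l))"])
    show "continuous_on {0..l} (\<lambda>s. Im (q (s / l)))"
      by (intro continuous_intros continuous_on_compose2[OF q(1)[unfolded path_def]])
         (use \<open>l > 0\<close> in auto)
    show "(g s - p) /\<^sub>R norm (g s - p) = cis (Im (q (s / l)))" if "s \<in> {0..l}" for s
    proof -
      have "g s - p = exp (q (s / l))"
        using q(3)[of "s / l"] that \<open>l > 0\<close> by auto
      then show ?thesis
        by (simp add: exp_eq_polar[of "q (s / l)"] norm_mult scaleR_conv_of_real field_simps)
    qed
    show "Im (q (l / l)) - Im (q (0 / l)) = 2 * pi * of_int d"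
      using arg_cong[OF q(2), of Im] d \<open>l > 0\<close>
      by (simp add: pathfinish_def pathstart_def)
  qed fact
  with d show ?thesis
    by simp
qed

end

theory Submission
  imports Defs
begin

text \<open>
  Measure the vector from \<open>p\<close> to the evolute in the moving frame: put
  \<open>z = (\<beta> - p) / n\<close>. Since \<open>n = \<i> t\<close>, the factorization \<open>\<beta> - p = \<i> t z\<close> and the
  additivity of degrees show that the winding index of \<open>\<beta>\<close> about \<open>p\<close> is the rotation
  index of \<open>\<alpha>\<close> plus the degree of \<open>z\<close>, so the theorem says that \<open>z\<close> has degree \<open>-n\<^sub>p\<close>.

  Two observations give this. First, \<open>z = (\<alpha> - p) / n + 1 / k\<close>, so the equation
  \<open>p = \<alpha> + \<rho> n\<close> with real \<open>\<rho> < 1 / k\<close> amounts to \<open>z = 1 / k - \<rho>\<close>: the normal segment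
  at \<open>s\<close> contains \<open>p\<close> exactly when \<open>z s\<close> is a positive real. Second, the Frenet
  equation yields \<open>((\<alpha> - p) / n)' = - \<i> k z\<close>, and \<open>1 / k\<close> is real, so that
  \<open>(Im z)' = - k Re z\<close>: the curve \<open>z\<close> traverses the positive real axis only downwards.
  A closed curve that avoids the origin and meets the positive real axis in
  such one-way transversal crossings has them in finite number, and each of them
  is one turn about the origin; this is \<open>circle_degree_eq_card_crossings\<close>, applied to
  the conjugate of \<open>z\<close>.
\<close>

section \<open>Degrees of closed curves in the punctured plane\<close>

text \<open>
  A lift of the angle is taken on the whole line rather than on one period, so that the
  endpoints of a period are interior points in the local arguments below.
\<close>

lemma periodic_angle_lift:
  fixes f :: "real \<Rightarrow> complex"
  assumes "l > 0" "continuous_on UNIV f" "\<And>s. f s \<noteq> 0" "f l = f 0"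
  obtains \<theta> where "continuous_on UNIV \<theta>" "\<And>s. f s = of_real (norm (f s)) * cis (\<theta> s)"
    "\<theta> l - \<theta> 0 = 2 * pi * of_int (circle_degree l (\<lambda>s. sgn (f s)))"
proof -
  obtain q where q: "continuous_on UNIV q" "\<And>s. f s = exp (q s)"
    using continuous_logarithm_on_contractible[OF assms(2) convex_imp_contractible[OF convex_UNIV]]
      assms(3) by (metis UNIV_I)
  have polar: "f s = of_real (norm (f s)) * cis (Im (q s))" for s
    using q(2)[of s] by (simp add: exp_eq_polar[of "q s"] norm_mult)
  obtain d where d: "q l = q 0 + of_real (of_int (2 * d) * pi) * \<i>"
    using assms(4) unfolding q(2) exp_eq by blast
  then have "Im (q l) - Im (q 0) = 2 * pi * of_int d"
    by simp
  moreover have "sgn (f s) = cis (Im (q s))" for s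
    using polar[of s] assms(3)[of s]
    by (metis mult.commute nonzero_mult_div_cancel_right norm_eq_zero of_real_eq_0_iff sgn_eq)
  moreover have "continuous_on UNIV (\<lambda>s. Im (q s))"
    by (intro continuous_intros q)
  moreover from this have "continuous_on {0..l} (\<lambda>s. Im (q s))"
    by (rule continuous_on_subset) simp
  ultimately show thesis
    using circle_degree_eqI[OF \<open>l > 0\<close>, of "\<lambda>s. Im (q s)" "\<lambda>s. sgn (f s)" d] polar
    by (intro that[of "\<lambda>s. Im (q s)"]) auto
qed

lemma circle_degree_mult:
  fixes f g :: "real \<Rightarrow> complex"
  assumes "l > 0" "continuous_on UNIV f" "\<And>s. f s \<noteq> 0" "f l = f 0"
    and "continuous_on UNIV g" "\<And>s. g s \<noteq> 0" "g l = g 0"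
  shows "circle_degree l (\<lambda>s. sgn (f s * g s)) =
         circle_degree l (\<lambda>s. sgn (f s)) + circle_degree l (\<lambda>s. sgn (g s))"
proof -
  obtain \<theta> where \<theta>: "continuous_on UNIV \<theta>" "\<And>s. f s = of_real (norm (f s)) * cis (\<theta> s)"
      "\<theta> l - \<theta> 0 = 2 * pi * of_int (circle_degree l (\<lambda>s. sgn (f s)))"
    using periodic_angle_lift[OF assms(1-4)] by blast
  obtain \<phi> where \<phi>: "continuous_on UNIV \<phi>" "\<And>s. g s = of_real (norm (g s)) * cis (\<phi> s)"
      "\<phi> l - \<phi> 0 = 2 * pi * of_int (circle_degree l (\<lambda>s. sgn (g s)))"
    using periodic_angle_lift[OF assms(1,5-7)] by blast
  show ?thesis
  proof (rule circle_degree_eqI[OF \<open>l > 0\<close>])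
    show "continuous_on {0..l} (\<lambda>s. \<theta> s + \<phi> s)"
      by (intro continuous_intros continuous_on_subset[OF \<theta>(1)] continuous_on_subset[OF \<phi>(1)]) auto
    show "sgn (f s * g s) = cis (\<theta> s + \<phi> s)" for s
    proof -
      have "sgn (f s) = cis (\<theta> s)" "sgn (g s) = cis (\<phi> s)"
        using \<theta>(2)[of s] \<phi>(2)[of s] assms(3)[of s] assms(6)[of s]
        by (metis mult.commute nonzero_mult_div_cancel_right norm_eq_zero of_real_eq_0_iff sgn_eq)+
      then show ?thesis
        by (simp add: sgn_mult cis_mult)
    qed
  qed (use \<theta>(3) \<phi>(3) in \<open>simp add: algebra_simps\<close>)
qed

lemma circle_degree_const:
  assumes "l > 0" "c \<noteq> 0"
  shows "circle_degree l (\<lambda>s. sgn c) = 0"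
  by (rule circle_degree_eqI[OF \<open>l > 0\<close>, where \<theta> = "\<lambda>_. Arg c"])
     (use \<open>c \<noteq> 0\<close> in \<open>auto simp: cis_Arg\<close>)

lemma circle_degree_cnj:
  fixes f :: "real \<Rightarrow> complex"
  assumes "l > 0" "continuous_on UNIV f" "\<And>s. f s \<noteq> 0" "f l = f 0"
  shows "circle_degree l (\<lambda>s. sgn (cnj (f s))) = - circle_degree l (\<lambda>s. sgn (f s))"
proof -
  have "sgn (f s * cnj (f s)) = sgn 1" for s
    unfolding complex_norm_square[symmetric] sgn_of_real using assms(3)[of s] by simp
  moreover have "continuous_on UNIV (\<lambda>s. cnj (f s))"
    by (intro continuous_intros assms)
  ultimately show ?thesis
    using circle_degree_mult[OF assms, of "\<lambda>s. cnj (f s)"]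
      circle_degree_const[OF \<open>l > 0\<close>, of 1] assms(3,4) by simp
qed

section \<open>The degree as a count of crossings\<close>

text \<open>
  The floor of \<open>g\<close> jumps by one at each upward crossing of an integer level and is locally
  constant elsewhere. The count over a half-open interval is additive under
  concatenation, so the local statement propagates by compactness of \<open>{a..b}\<close>. The
  interval is open on the left because the floor is right-continuous along an upward
  crossing: a crossing at \<open>a\<close> is already included in \<open>\<lfloor>g a\<rfloor>\<close>.
\<close>

lemma card_upward_integer_crossings:
  fixes g :: "real \<Rightarrow> real"
  assumes cont: "continuous_on UNIV g"
    and left: "\<And>x. g x \<in> \<int> \<Longrightarrow> \<forall>\<^sub>F y in at_left x. g y < g x"
    and right: "\<And>x. g x \<in> \<int> \<Longrightarrow> \<forall>\<^sub>F y in at_right x. g x < g y"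
    and "a \<le> b"
  shows "finite {x \<in> {a<..b}. g x \<in> \<int>} \<and>
         int (card {x \<in> {a<..b}. g x \<in> \<int>}) = \<lfloor>g b\<rfloor> - \<lfloor>g a\<rfloor>"
  using \<open>a \<le> b\<close>
proof (induction rule: Bolzano)
  case (trans a b c)
  have split: "{x \<in> {a<..c}. g x \<in> \<int>} = {x \<in> {a<..b}. g x \<in> \<int>} \<union> {x \<in> {b<..c}. g x \<in> \<int>}"
    using trans by auto
  have "card {x \<in> {a<..c}. g x \<in> \<int>} =
      card {x \<in> {a<..b}. g x \<in> \<int>} + card {x \<in> {b<..c}. g x \<in> \<int>}"
    unfolding split by (rule card_Un_disjoint) (use trans in auto)
  with trans split show ?case
    by simp
next
  case (local x)
  have tends: "(g \<longlongrightarrow> g x) (at x)"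
    using cont by (simp add: continuous_on_eq_continuous_at isContD)
  show ?case
  proof (cases "g x \<in> \<int>")
    case False
    then have "of_int \<lfloor>g x\<rfloor> < g x"
      by (metis Ints_of_int floor_correct order_le_less)
    then have "\<forall>\<^sub>F y in at x. of_int \<lfloor>g x\<rfloor> < g y \<and> g y < of_int \<lfloor>g x\<rfloor> + 1"
      using tends by (intro eventually_conj order_tendstoD) auto
    then obtain d where d: "d > 0"
        "\<And>y. y \<noteq> x \<Longrightarrow> dist y x < d \<Longrightarrow> of_int \<lfloor>g x\<rfloor> < g y \<and> g y < of_int \<lfloor>g x\<rfloor> + 1"
      unfolding eventually_at by auto
    have near: "of_int \<lfloor>g x\<rfloor> < g y \<and> g y < of_int \<lfloor>g x\<rfloor> + 1" if "dist y x < d" for y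
      using d(2)[of y] that \<open>of_int \<lfloor>g x\<rfloor> < g x\<close> by (cases "y = x") auto
    have floor: "\<lfloor>g y\<rfloor> = \<lfloor>g x\<rfloor>" and nonint: "g y \<notin> \<int>" if "dist y x < d" for y
    proof -
      show *: "\<lfloor>g y\<rfloor> = \<lfloor>g x\<rfloor>"
        using near[OF that] by (intro floor_unique) auto
      show "g y \<notin> \<int>"
        using near[OF that] * by (auto elim!: Ints_cases)
    qed
    show ?thesis
    proof (intro exI[of _ d] conjI allI impI \<open>d > 0\<close>)
      fix a b assume ab: "a \<le> x \<and> x \<le> b \<and> b - a < d"
      then have no_crossing: "{y \<in> {a<..b}. g y \<in> \<int>} = {}"
        using nonint by (auto simp: dist_real_def)
      show "finite {y \<in> {a<..b}. g y \<in> \<int>}"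
        unfolding no_crossing by simp
      show "int (card {y \<in> {a<..b}. g y \<in> \<int>}) = \<lfloor>g b\<rfloor> - \<lfloor>g a\<rfloor>"
        unfolding no_crossing using floor[of a] floor[of b] ab by (auto simp: dist_real_def)
    qed
  next
    case True
    then obtain m where m: "g x = of_int m"
      by (rule Ints_cases)
    have "\<forall>\<^sub>F y in at x. of_int m - 1 < g y \<and> g y < of_int m + 1"
      using tends by (intro eventually_conj order_tendstoD) (auto simp: m)
    moreover have "\<forall>\<^sub>F y in at x. y < x \<longrightarrow> g y < g x"
      using left[OF True] unfolding eventually_at_filter by (rule eventually_mono) auto
    moreover have "\<forall>\<^sub>F y in at x. x < y \<longrightarrow> g x < g y"
      using right[OF True] unfolding eventually_at_filter by (rule eventually_mono) auto
    ultimately have "\<forall>\<^sub>F y in at x. (of_int m - 1 < g y \<and> g y < of_int m + 1) \<and>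
        (y < x \<longrightarrow> g y < g x) \<and> (x < y \<longrightarrow> g x < g y)"
      by eventually_elim blast
    then obtain d where d: "d > 0"
        "\<And>y. y \<noteq> x \<Longrightarrow> dist y x < d \<Longrightarrow> (of_int m - 1 < g y \<and> g y < of_int m + 1) \<and>
            (y < x \<longrightarrow> g y < g x) \<and> (x < y \<longrightarrow> g x < g y)"
      unfolding eventually_at by auto
    have below: "\<lfloor>g y\<rfloor> = m - 1" "g y \<notin> \<int>" if "y < x" "x - y < d" for y
    proof -
      have *: "of_int m - 1 < g y" "g y < of_int m"
        using d(2)[of y] that by (auto simp: dist_real_def m)
      then show "\<lfloor>g y\<rfloor> = m - 1"
        by (intro floor_unique) auto
      then show "g y \<notin> \<int>"
        using * by (auto elim!: Ints_cases)
    qed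
    have above: "\<lfloor>g y\<rfloor> = m" "g y \<notin> \<int>" if "x < y" "y - x < d" for y
    proof -
      have *: "of_int m < g y" "g y < of_int m + 1"
        using d(2)[of y] that by (auto simp: dist_real_def m)
      then show "\<lfloor>g y\<rfloor> = m"
        by (intro floor_unique) auto
      then show "g y \<notin> \<int>"
        using * by (auto elim!: Ints_cases)
    qed
    show ?thesis
    proof (intro exI[of _ d] conjI allI impI \<open>d > 0\<close>)
      fix a b assume ab: "a \<le> x \<and> x \<le> b \<and> b - a < d"
      have "g y \<notin> \<int>" if "y \<in> {a<..b}" "y \<noteq> x" for y
        using below(2)[of y] above(2)[of y] that ab by (cases y x rule: linorder_cases) auto
      then have crossings: "{y \<in> {a<..b}. g y \<in> \<int>} = (if a < x then {x} else {})"
        using True ab by auto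
      show "finite {y \<in> {a<..b}. g y \<in> \<int>}"
        unfolding crossings by simp
      have "\<lfloor>g b\<rfloor> = m"
        using above(1)[of b] ab m by (cases "b = x") auto
      moreover have "\<lfloor>g a\<rfloor> = (if a < x then m - 1 else m)"
        using below(1)[of a] ab m by (cases "a = x") auto
      ultimately show "int (card {y \<in> {a<..b}. g y \<in> \<int>}) = \<lfloor>g b\<rfloor> - \<lfloor>g a\<rfloor>"
        unfolding crossings by simp
    qed
  qed
qed

lemma sgn_sin_near_zero:
  fixes x :: real
  assumes "\<bar>x\<bar> < pi"
  shows "sgn (sin x) = sgn x"
  using assms sin_gt_zero[of x] sin_gt_zero[of "- x"] by (cases x "0::real" rule: linorder_cases) auto

text \<open>
  In units of full turns, the angle of \<open>f\<close> is an integer exactly on the positive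
  real axis. There the imaginary part of \<open>f\<close> has the sign of the angle measured from that
  integer, so its positive derivative makes the crossing of the integer level an upward one.
\<close>

lemma circle_degree_eq_card_crossings:
  fixes f :: "real \<Rightarrow> complex"
  assumes "l > 0" "continuous_on UNIV f" "\<And>s. f s \<noteq> 0" "\<And>s. f (s + l) = f s"
    and up: "\<And>s. f s \<in> \<real> \<and> Re (f s) > 0 \<Longrightarrow> \<exists>D>0. ((\<lambda>x. Im (f x)) has_real_derivative D) (at s)"
  shows "finite {s \<in> {0..<l}. f s \<in> \<real> \<and> Re (f s) > 0} \<and>
         int (card {s \<in> {0..<l}. f s \<in> \<real> \<and> Re (f s) > 0}) = circle_degree l (\<lambda>s. sgn (f s))"
proof -
  define d where "d = circle_degree l (\<lambda>s. sgn (f s))"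
  have "f l = f 0"
    using assms(4)[of 0] by simp
  then obtain \<theta> where \<theta>: "continuous_on UNIV \<theta>" "\<And>s. f s = of_real (norm (f s)) * cis (\<theta> s)"
      "\<theta> l - \<theta> 0 = 2 * pi * of_int d"
    using periodic_angle_lift[OF assms(1-3)] unfolding d_def by blast
  define g where "g s = \<theta> s / (2 * pi)" for s
  have f_g: "f s = of_real (norm (f s)) * cis (2 * pi * g s)" for s
    using \<theta>(2)[of s] by (simp add: g_def)
  have cont: "continuous_on UNIV g"
    unfolding g_def by (intro continuous_intros \<theta>) auto
  have Re_f: "Re (f s) = norm (f s) * cos (2 * pi * g s)"
    and Im_f: "Im (f s) = norm (f s) * sin (2 * pi * g s)" for s
    using arg_cong[OF f_g[of s], of Re] arg_cong[OF f_g[of s], of Im] by simp_all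
  have iff: "f s \<in> \<real> \<and> Re (f s) > 0 \<longleftrightarrow> g s \<in> \<int>" for s
  proof
    assume "f s \<in> \<real> \<and> Re (f s) > 0"
    then have "sin (2 * pi * g s) = 0" "cos (2 * pi * g s) > 0"
      using Re_f[of s] Im_f[of s] assms(3)[of s] by (auto simp: complex_is_Real_iff zero_less_mult_iff)
    moreover from this(1) have "\<bar>cos (2 * pi * g s)\<bar> = 1"
      by (rule sin_zero_abs_cos_one)
    ultimately have "cos (2 * pi * g s) = 1"
      by simp
    then obtain m :: int where "2 * pi * g s = of_int m * 2 * pi"
      using cos_one_2pi_int by blast
    then show "g s \<in> \<int>"
      by simp
  next
    assume "g s \<in> \<int>"
    then obtain m where "g s = of_int m"
      by (rule Ints_cases)
    then show "f s \<in> \<real> \<and> Re (f s) > 0"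
      using Re_f[of s] Im_f[of s] assms(3)[of s] by (simp add: complex_is_Real_iff)
  qed
  have sides: "(\<forall>\<^sub>F y in at_left x. g y < g x) \<and> (\<forall>\<^sub>F y in at_right x. g x < g y)"
    if crossing: "g x \<in> \<int>" for x
  proof -
    from crossing obtain m where m: "g x = of_int m"
      by (rule Ints_cases)
    have "Im (f x) = 0"
      using Im_f[of x] by (simp add: m)
    obtain D where D: "D > 0" "((\<lambda>x. Im (f x)) has_real_derivative D) (at x)"
      using up[of x] iff[of x] crossing by blast
    obtain e1 where e1: "e1 > 0" "\<And>h. h > 0 \<Longrightarrow> h < e1 \<Longrightarrow> Im (f x) < Im (f (x + h))"
      using DERIV_pos_inc_right[OF D(2,1)] by blast
    obtain e2 where e2: "e2 > 0" "\<And>h. h > 0 \<Longrightarrow> h < e2 \<Longrightarrow> Im (f (x - h)) < Im (f x)"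
      using DERIV_pos_inc_left[OF D(2,1)] by blast
    have right: "\<forall>\<^sub>F y in at_right x. 0 < Im (f y)"
    proof -
      have "0 < Im (f y)" if "x < y" "y < x + e1" for y
        using e1(2)[of "y - x"] that \<open>Im (f x) = 0\<close> by simp
      then show ?thesis
        unfolding eventually_at_right_field using e1(1) by (intro exI[of _ "x + e1"]) simp
    qed
    have left: "\<forall>\<^sub>F y in at_left x. Im (f y) < 0"
    proof -
      have "Im (f y) < 0" if "y < x" "x - e2 < y" for y
        using e2(2)[of "x - y"] that \<open>Im (f x) = 0\<close> by simp
      then show ?thesis
        unfolding eventually_at_left_field using e2(1) by (intro exI[of _ "x - e2"]) simp
    qed
    have "(g \<longlongrightarrow> g x) (at x)"
      using cont by (simp add: continuous_on_eq_continuous_at isContD)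
    then have "\<forall>\<^sub>F y in at x. \<bar>g y - of_int m\<bar> < 1 / 2"
      unfolding m by (drule_tac tendstoD[where e = "1 / 2"]) (auto simp: dist_real_def)
    then have same_sign: "\<forall>\<^sub>F y in at x. sgn (Im (f y)) = sgn (g y - g x)"
    proof (rule eventually_mono)
      fix y assume "\<bar>g y - of_int m\<bar> < 1 / 2"
      then have "\<bar>2 * pi * (g y - of_int m)\<bar> < pi"
        using mult_strict_left_mono[of "\<bar>g y - of_int m\<bar>" "1 / 2" "2 * pi"] by (simp add: abs_mult)
      moreover have "sin (2 * pi * (g y - of_int m)) = sin (2 * pi * g y)"
        by (simp add: right_diff_distrib sin_diff)
      ultimately have "sgn (sin (2 * pi * g y)) = sgn (g y - of_int m)"
        using sgn_sin_near_zero[of "2 * pi * (g y - of_int m)"] by (simp add: sgn_mult)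
      then show "sgn (Im (f y)) = sgn (g y - g x)"
        using Im_f[of y] assms(3)[of y] by (simp add: sgn_mult m)
    qed
    have "\<forall>\<^sub>F y in at_left x. sgn (Im (f y)) = sgn (g y - g x)"
      using same_sign unfolding eventually_at_split by simp
    then have "\<forall>\<^sub>F y in at_left x. g y < g x"
      using left by eventually_elim (simp add: sgn_if split: if_splits)
    moreover have "\<forall>\<^sub>F y in at_right x. sgn (Im (f y)) = sgn (g y - g x)"
      using same_sign unfolding eventually_at_split by simp
    then have "\<forall>\<^sub>F y in at_right x. g x < g y"
      using right by eventually_elim (simp add: sgn_if split: if_splits)
    ultimately show ?thesis
      by simp
  qed
  have count: "finite {s \<in> {0<..l}. g s \<in> \<int>} \<and>
      int (card {s \<in> {0<..l}. g s \<in> \<int>}) = \<lfloor>g l\<rfloor> - \<lfloor>g 0\<rfloor>"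
    using sides \<open>l > 0\<close> by (intro card_upward_integer_crossings cont) auto
  have "g l = g 0 + of_int d"
    using \<theta>(3) by (simp add: g_def field_simps)
  then have floors: "\<lfloor>g l\<rfloor> - \<lfloor>g 0\<rfloor> = d" and ends: "g l \<in> \<int> \<longleftrightarrow> g 0 \<in> \<int>"
    by (simp, metis Ints_add Ints_diff Ints_of_int add_diff_cancel_right')
  \<comment> \<open>The floor counts crossings in \<open>(0, l]\<close>; by periodicity \<open>[0, l)\<close> has as many.\<close>
  define M where "M = {s \<in> {0<..<l}. g s \<in> \<int>}"
  have "{s \<in> {0<..l}. g s \<in> \<int>} = (if g 0 \<in> \<int> then insert l M else M)"
    using ends \<open>l > 0\<close> by (auto simp: M_def less_le)
  moreover have "{s \<in> {0..<l}. g s \<in> \<int>} = (if g 0 \<in> \<int> then insert 0 M else M)"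
    using \<open>l > 0\<close> by (auto simp: M_def less_le)
  moreover have "0 \<notin> M" "l \<notin> M"
    by (auto simp: M_def)
  ultimately show ?thesis
    using count floors unfolding iff d_def by (simp split: if_splits)
qed

section \<open>The evolute in the moving frame\<close>

lemma has_vector_derivative_periodic:
  assumes "\<And>s. f (s + l) = f s" "(f has_vector_derivative D) (at (s + l))"
  shows "(f has_vector_derivative D) (at s)"
proof -
  have "((\<lambda>x. x + l) has_vector_derivative 1) (at s)"
    by (auto intro!: derivative_eq_intros)
  then have "(f \<circ> (\<lambda>x. x + l) has_vector_derivative 1 *\<^sub>R D) (at s)"
    using assms(2) by (rule vector_diff_chain_at)
  moreover have "f \<circ> (\<lambda>x. x + l) = f"
    using assms(1) by auto
  ultimately show ?thesis
    by simp
qed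

lemma smooth_curve_vector_derivative:
  assumes "smooth_curve \<gamma>"
  shows "smooth_curve (\<lambda>s. vector_derivative \<gamma> (at s))"
  using assms unfolding smooth_curve_def by (metis funpow_Suc_right o_apply)

context
  fixes \<alpha> :: "real \<Rightarrow> complex" and l :: real
  assumes curve: "closed_unit_speed_curve l \<alpha>"
begin

lemma curve_has_vector_derivative: "(\<alpha> has_vector_derivative unit_tangent \<alpha> s) (at s)"
proof -
  have "((\<lambda>f x. vector_derivative f (at x)) ^^ 0) \<alpha> differentiable at s"
    using curve unfolding closed_unit_speed_curve_def smooth_curve_def by blast
  then show ?thesis
    by (simp add: unit_tangent_def vector_derivative_works)
qed

lemma norm_unit_normal: "norm (unit_normal \<alpha> s) = 1"
  using curve by (simp add: unit_normal_def unit_tangent_def norm_mult closed_unit_speed_curve_def)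

lemma unit_normal_mult_cnj: "unit_normal \<alpha> s * cnj (unit_normal \<alpha> s) = 1"
  by (simp add: norm_unit_normal flip: complex_norm_square)

lemma unit_normal_has_vector_derivative:
  "(unit_normal \<alpha> has_vector_derivative \<i> * (curvature \<alpha> s *\<^sub>R unit_normal \<alpha> s)) (at s)"
  unfolding unit_normal_def[of \<alpha>, abs_def]
  using has_vector_derivative_mult_right[OF frenet_equation[OF curve, of s], of \<i>]
  by (simp add: unit_normal_def)

lemma unit_tangent_periodic: "unit_tangent \<alpha> (s + l) = unit_tangent \<alpha> s"
  using curve has_vector_derivative_periodic[OF _ curve_has_vector_derivative[of "s + l"]]
    curve_has_vector_derivative[of s] vector_derivative_unique_at
  unfolding closed_unit_speed_curve_def by blast

lemma unit_normal_periodic: "unit_normal \<alpha> (s + l) = unit_normal \<alpha> s"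
  by (simp add: unit_normal_def unit_tangent_periodic)

lemma curvature_periodic: "curvature \<alpha> (s + l) = curvature \<alpha> s"
proof -
  have "curvature \<alpha> (s + l) *\<^sub>R unit_normal \<alpha> (s + l) = curvature \<alpha> s *\<^sub>R unit_normal \<alpha> s"
    using has_vector_derivative_periodic[OF unit_tangent_periodic
        frenet_equation[OF curve, of "s + l"]] frenet_equation[OF curve, of s]
    by (rule vector_derivative_unique_at)
  then show ?thesis
    using norm_unit_normal[of s] by (auto simp: unit_normal_periodic)
qed

lemma evolute_periodic: "evolute \<alpha> (s + l) = evolute \<alpha> s"
  using curve
  by (simp add: evolute_def curvature_periodic unit_normal_periodic closed_unit_speed_curve_def)

lemma continuous_unit_tangent: "continuous_on UNIV (unit_tangent \<alpha>)"
  using frenet_equation[OF curve]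
  by (auto intro!: continuous_at_imp_continuous_on has_vector_derivative_continuous)

lemma continuous_unit_normal: "continuous_on UNIV (unit_normal \<alpha>)"
  unfolding unit_normal_def[abs_def] by (intro continuous_intros continuous_unit_tangent)

text \<open>
  The function \<open>k\<close> is the component along \<open>n\<close> of \<open>t' = k n\<close>, whose continuity comes from
  the third derivative of \<open>\<alpha>\<close>.
\<close>

lemma continuous_curvature: "continuous_on UNIV (curvature \<alpha>)"
proof -
  have "smooth_curve (\<lambda>s. vector_derivative (unit_tangent \<alpha>) (at s))"
    using curve unfolding closed_unit_speed_curve_def unit_tangent_def[of \<alpha>, abs_def]
    by (intro smooth_curve_vector_derivative) auto
  moreover have "(\<lambda>s. vector_derivative (unit_tangent \<alpha>) (at s)) =
      (\<lambda>s. curvature \<alpha> s *\<^sub>R unit_normal \<alpha> s)"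
    using frenet_equation[OF curve] by (auto intro!: vector_derivative_at)
  ultimately have "smooth_curve (\<lambda>s. curvature \<alpha> s *\<^sub>R unit_normal \<alpha> s)"
    by simp
  then have "((\<lambda>f x. vector_derivative f (at x)) ^^ 0) (\<lambda>s. curvature \<alpha> s *\<^sub>R unit_normal \<alpha> s)
      differentiable at s" for s
    unfolding smooth_curve_def by blast
  then have "continuous_on UNIV (\<lambda>s. curvature \<alpha> s *\<^sub>R unit_normal \<alpha> s)"
    by (auto intro!: continuous_at_imp_continuous_on differentiable_imp_continuous_within)
  then have "continuous_on UNIV
      (\<lambda>s. Re (curvature \<alpha> s *\<^sub>R unit_normal \<alpha> s * cnj (unit_normal \<alpha> s)))"
    by (intro continuous_on_Re continuous_on_mult continuous_on_cnj continuous_unit_normal)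
  moreover have "Re (curvature \<alpha> s *\<^sub>R unit_normal \<alpha> s * cnj (unit_normal \<alpha> s)) = curvature \<alpha> s" for s
    unfolding mult_scaleR_left unit_normal_mult_cnj by simp
  ultimately show ?thesis
    by (simp only:)
qed

end

text \<open>
  The curve \<open>z = (\<beta> - p) / n\<close>; the inverse of the unit vector \<open>n\<close> is written as its conjugate,
  which is easier to differentiate.
\<close>

definition evolute_in_frame :: "(real \<Rightarrow> complex) \<Rightarrow> complex \<Rightarrow> real \<Rightarrow> complex" where
  "evolute_in_frame \<alpha> p s = (evolute \<alpha> s - p) * cnj (unit_normal \<alpha> s)"

lemma evolute_in_frame_eq:
  assumes "closed_unit_speed_curve l \<alpha>"
  shows "evolute_in_frame \<alpha> p s =
         (\<alpha> s - p) * cnj (unit_normal \<alpha> s) + of_real (1 / curvature \<alpha> s)"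
  unfolding evolute_in_frame_def evolute_def
  using unit_normal_mult_cnj[OF assms, of s]
  by (simp add: algebra_simps scaleR_conv_of_real)

text \<open>
  The condition \<open>p = \<alpha> + \<rho> n\<close> says that \<open>(\<alpha> - p) / n = - \<rho>\<close>, which is \<open>z = 1 / k - \<rho>\<close>; the bound
  on \<open>\<rho>\<close> is the positivity of this number.
\<close>

lemma normal_segment_iff:
  assumes "closed_unit_speed_curve l \<alpha>"
  shows "p \<in> normal_segment \<alpha> s \<longleftrightarrow>
         evolute_in_frame \<alpha> p s \<in> \<real> \<and> Re (evolute_in_frame \<alpha> p s) > 0"
proof -
  let ?n = "unit_normal \<alpha> s"
  have "p = \<alpha> s + \<rho> *\<^sub>R ?n \<longleftrightarrow> evolute_in_frame \<alpha> p s = of_real (1 / curvature \<alpha> s - \<rho>)" for \<rho>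
  proof -
    have "p = \<alpha> s + \<rho> *\<^sub>R ?n \<longleftrightarrow> \<alpha> s - p = of_real (- \<rho>) * ?n"
      by (auto simp: algebra_simps scaleR_conv_of_real)
    also have "\<dots> \<longleftrightarrow> (\<alpha> s - p) * cnj ?n = of_real (- \<rho>)"
      using unit_normal_mult_cnj[OF assms, of s]
      by (metis mult.assoc mult.commute mult.right_neutral)
    also have "\<dots> \<longleftrightarrow> evolute_in_frame \<alpha> p s = of_real (1 / curvature \<alpha> s - \<rho>)"
      unfolding evolute_in_frame_eq[OF assms] by (auto simp: algebra_simps)
    finally show ?thesis .
  qed
  then have "p \<in> normal_segment \<alpha> s \<longleftrightarrow>
      (\<exists>\<rho>. evolute_in_frame \<alpha> p s = of_real (1 / curvature \<alpha> s - \<rho>) \<and> \<rho> < 1 / curvature \<alpha> s)"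
    by (auto simp: normal_segment_def)
  also have "\<dots> \<longleftrightarrow> (\<exists>r>0. evolute_in_frame \<alpha> p s = of_real r)"
  proof
    assume "\<exists>r>0. evolute_in_frame \<alpha> p s = of_real r"
    then obtain r where "r > 0" "evolute_in_frame \<alpha> p s = of_real r"
      by blast
    then show "\<exists>\<rho>. evolute_in_frame \<alpha> p s = of_real (1 / curvature \<alpha> s - \<rho>) \<and> \<rho> < 1 / curvature \<alpha> s"
      by (intro exI[of _ "1 / curvature \<alpha> s - r"]) simp
  qed (metis diff_gt_0_iff_gt)
  also have "\<dots> \<longleftrightarrow> evolute_in_frame \<alpha> p s \<in> \<real> \<and> Re (evolute_in_frame \<alpha> p s) > 0"
    by (auto elim!: Reals_cases)
  finally show ?thesis .
qed

text \<open>
  The frame turns at the rate \<open>k\<close>, so \<open>(\<alpha> - p) / n\<close> has derivative \<open>- \<i> k z\<close>. The radius of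
  curvature \<open>1 / k\<close> enters \<open>z\<close> in the real direction, and its derivative does
  not affect the imaginary part.
\<close>

lemma Im_evolute_in_frame_has_derivative:
  assumes "closed_unit_speed_curve l \<alpha>" "curvature \<alpha> s \<noteq> 0"
  shows "((\<lambda>s. Im (evolute_in_frame \<alpha> p s)) has_real_derivative
          - curvature \<alpha> s * Re (evolute_in_frame \<alpha> p s)) (at s)"
proof -
  let ?n = "unit_normal \<alpha>" and ?k = "curvature \<alpha> s"
  have "((\<lambda>s. (\<alpha> s - p) * cnj (?n s)) has_vector_derivative
      (\<alpha> s - p) * cnj (\<i> * (?k *\<^sub>R ?n s)) + (unit_tangent \<alpha> s - 0) * cnj (?n s)) (at s)"
    by (intro has_vector_derivative_mult has_vector_derivative_cnj has_vector_derivative_diff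
        has_vector_derivative_const curve_has_vector_derivative[OF assms(1)]
        unit_normal_has_vector_derivative[OF assms(1)])
  moreover have "unit_tangent \<alpha> s = - \<i> * ?n s"
    by (simp add: unit_normal_def)
  then have "(\<alpha> s - p) * cnj (\<i> * (?k *\<^sub>R ?n s)) + (unit_tangent \<alpha> s - 0) * cnj (?n s) =
      - \<i> * ?k * evolute_in_frame \<alpha> p s"
    using unit_normal_mult_cnj[OF assms(1), of s] \<open>?k \<noteq> 0\<close>
    unfolding evolute_in_frame_eq[OF assms(1)]
    by (simp add: algebra_simps scaleR_conv_of_real)
  ultimately have "((\<lambda>s. (\<alpha> s - p) * cnj (?n s)) has_vector_derivative
      - \<i> * ?k * evolute_in_frame \<alpha> p s) (at s)"
    by simp
  then have "((\<lambda>s. Im ((\<alpha> s - p) * cnj (?n s))) has_real_derivative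
      Im (- \<i> * ?k * evolute_in_frame \<alpha> p s)) (at s)"
    unfolding has_real_derivative_iff_has_vector_derivative
    by (rule bounded_linear.has_vector_derivative[OF bounded_linear_Im])
  moreover have "Im (evolute_in_frame \<alpha> p s) = Im ((\<alpha> s - p) * cnj (?n s))" for s
    unfolding evolute_in_frame_eq[OF assms(1)] plus_complex.sel(2) Im_complex_of_real by simp
  ultimately show ?thesis
    by simp
qed

theorem theorem3:
  fixes \<alpha> :: "real \<Rightarrow> complex" and l :: real and p :: complex
  assumes "closed_unit_speed_curve l \<alpha>"
    and "\<And>s. curvature \<alpha> s > 0"
    and "p \<notin> range \<alpha>"
    and "p \<notin> range (evolute \<alpha>)"
  shows "finite {s \<in> {0..<l}. p \<in> normal_segment \<alpha> s} \<and>
         winding_index l (evolute \<alpha>) p =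
           rotation_index l \<alpha> - int (card {s \<in> {0..<l}. p \<in> normal_segment \<alpha> s})"
proof -
  let ?n = "unit_normal \<alpha>" and ?z = "evolute_in_frame \<alpha> p"
  let ?N = "{s \<in> {0..<l}. p \<in> normal_segment \<alpha> s}"
  have "l > 0"
    using assms(1) by (simp add: closed_unit_speed_curve_def)
  have cont_\<alpha>: "continuous_on UNIV \<alpha>"
    using curve_has_vector_derivative[OF assms(1)]
    by (auto intro!: continuous_at_imp_continuous_on has_vector_derivative_continuous)
  have cont_z: "continuous_on UNIV ?z"
    unfolding evolute_in_frame_eq[OF assms(1), abs_def]
    using assms(2) by (intro continuous_intros cont_\<alpha> continuous_unit_normal[OF assms(1)]
        continuous_curvature[OF assms(1)]) (auto simp: less_imp_neq[symmetric])
  have n_nz: "?n s \<noteq> 0" for s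
    using norm_unit_normal[OF assms(1), of s] by auto
  have z_nz: "?z s \<noteq> 0" for s
    using assms(4) n_nz[of s] by (auto simp: evolute_in_frame_def)
  have z_per: "?z (s + l) = ?z s" for s
    by (simp add: evolute_in_frame_def evolute_periodic[OF assms(1)] unit_normal_periodic[OF assms(1)])
  have n_ends: "?n l = ?n 0" and z_ends: "?z l = ?z 0"
    using unit_normal_periodic[OF assms(1), of 0] z_per[of 0] by simp_all
  have t_nz: "unit_tangent \<alpha> s \<noteq> 0" for s
    using n_nz[of s] by (auto simp: unit_normal_def)
  have t_ends: "unit_tangent \<alpha> l = unit_tangent \<alpha> 0"
    using unit_tangent_periodic[OF assms(1), of 0] by simp

  \<comment> \<open>Conjugation turns the downward crossings of the positive real axis into upward ones.\<close>
  have "finite {s \<in> {0..<l}. cnj (?z s) \<in> \<real> \<and> Re (cnj (?z s)) > 0} \<and>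
      int (card {s \<in> {0..<l}. cnj (?z s) \<in> \<real> \<and> Re (cnj (?z s)) > 0}) =
      circle_degree l (\<lambda>s. sgn (cnj (?z s)))"
  proof (rule circle_degree_eq_card_crossings[OF \<open>l > 0\<close>])
    show "continuous_on UNIV (\<lambda>s. cnj (?z s))"
      by (intro continuous_intros cont_z)
    show "\<exists>D>0. ((\<lambda>x. Im (cnj (?z x))) has_real_derivative D) (at s)"
      if "cnj (?z s) \<in> \<real> \<and> Re (cnj (?z s)) > 0" for s
      using DERIV_minus[OF Im_evolute_in_frame_has_derivative[OF assms(1), of s p]]
        assms(2)[of s] that
      by (intro exI[of _ "curvature \<alpha> s * Re (?z s)"]) auto
  qed (use z_nz z_per in auto)
  moreover have "p \<in> normal_segment \<alpha> s \<longleftrightarrow> cnj (?z s) \<in> \<real> \<and> Re (cnj (?z s)) > 0" for s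
    unfolding normal_segment_iff[OF assms(1)] by (simp add: complex_is_Real_iff)
  ultimately have count: "finite ?N" "int (card ?N) = - circle_degree l (\<lambda>s. sgn (?z s))"
    using circle_degree_cnj[OF \<open>l > 0\<close> cont_z z_nz z_ends] by simp_all

  have "evolute \<alpha> s - p = ?n s * ?z s" for s
    using unit_normal_mult_cnj[OF assms(1), of s] by (simp add: evolute_in_frame_def mult.left_commute)
  then have "winding_index l (evolute \<alpha>) p = circle_degree l (\<lambda>s. sgn (?n s * ?z s))"
    by (simp add: winding_index_def sgn_div_norm)
  also have "\<dots> = circle_degree l (\<lambda>s. sgn (?n s)) + circle_degree l (\<lambda>s. sgn (?z s))"
    by (rule circle_degree_mult[OF \<open>l > 0\<close> continuous_unit_normal[OF assms(1)] n_nz n_ends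
          cont_z z_nz z_ends])
  also have "circle_degree l (\<lambda>s. sgn (?n s)) = rotation_index l \<alpha>"
    unfolding unit_normal_def
    using circle_degree_mult[OF \<open>l > 0\<close> _ _ _ continuous_unit_tangent[OF assms(1)] t_nz t_ends,
        of "\<lambda>_. \<i>"] circle_degree_const[OF \<open>l > 0\<close>, of \<i>]
    by (simp add: rotation_index_def unit_tangent_def sgn_div_norm)
  finally show ?thesis
    using count by simp
qed

end
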